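(* Let $(G,* )$ be a groupoid and let $A:G\to\mathbb{R}$ be a function. Assume that there exist two functions $f,g:G\to\mathbb{R}$ such that $$A(x*y)=f(x)f(y)-g(x)g(y)$$ holds for all $x,y\in G$. Then $$A(x*x)\,A(y*y)\leq A(x*y)^2$$ for all $x,y\in G$.
   Context: A groupoid $(G,* )$ is a set $G$ together with a binary operation $*:G\times G\to G$ (a magma); no associativity, commutativity or other property is assumed. $A(u)^2$ denotes $(A(u))^2$. *)

theory Defs
  imports Complex_Main
begin

end

theory Submission
  imports Defs
begin

text \<open>The representation makes \<open>A (x \<star> y)\<close> the Lorentzian form
  \<open>a c - b d\<close> of the vectors \<open>(a, b) = (f x, g x)\<close> and \<open>(c, d) = (f y, g y)\<close>, so the claim is a
  Cauchy--Schwarz inequality with the sign reversed. It holds because the Gram determinant of a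
  form of signature \<open>(1, 1)\<close> is minus the square of the ordinary determinant \<open>a d - b c\<close>.\<close>

lemma lorentz_gram_identity:
  fixes a b c d :: "'a::comm_ring_1"
  shows "(a * a - b * b) * (c * c - d * d) = (a * c - b * d)\<^sup>2 - (a * d - b * c)\<^sup>2"
  by (simp add: power2_eq_square algebra_simps)

theorem theorem3p1:
  fixes G :: "'a set"
    and gop :: "'a \<Rightarrow> 'a \<Rightarrow> 'a"  (infixl "\<star>" 70)
    and A :: "'a \<Rightarrow> real"
  assumes closed: "\<And>x y. x \<in> G \<Longrightarrow> y \<in> G \<Longrightarrow> x \<star> y \<in> G"
    and repr: "\<exists>f g :: 'a \<Rightarrow> real. \<forall>x\<in>G. \<forall>y\<in>G. A (x \<star> y) = f x * f y - g x * g y"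
  shows "\<forall>x\<in>G. \<forall>y\<in>G. A (x \<star> x) * A (y \<star> y) \<le> (A (x \<star> y))\<^sup>2"
proof (intro ballI)
  fix x y
  assume x: "x \<in> G" and y: "y \<in> G"
  obtain f g :: "'a \<Rightarrow> real"
    where A_eq: "\<And>u v. u \<in> G \<Longrightarrow> v \<in> G \<Longrightarrow> A (u \<star> v) = f u * f v - g u * g v"
    using repr by blast
  have "A (x \<star> x) * A (y \<star> y) = (A (x \<star> y))\<^sup>2 - (f x * g y - g x * f y)\<^sup>2"
    unfolding A_eq[OF x x] A_eq[OF y y] A_eq[OF x y] by (rule lorentz_gram_identity)
  also have "\<dots> \<le> (A (x \<star> y))\<^sup>2"
    by simp
  finally show "A (x \<star> x) * A (y \<star> y) \<le> (A (x \<star> y))\<^sup>2" .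
qed

end
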